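(* Let $F$ be a field of characteristic not $2$, let $R$ be a unital commutative associative $F$-algebra which is an integral domain, and let $S$ be a unital commutative associative $F$-algebra. Then the following two conditions are equivalent. (1) $\mathfrak{sl}_2(R)\simeq\mathfrak{sl}_2(S)$ as Lie algebras over $F$. (2) $R\simeq S$ as $F$-algebras.
   Context: For a unital commutative associative $F$-algebra $A$, $\mathfrak{sl}_2(A)$ denotes the set of $2\times 2$ matrices $\begin{pmatrix}a&b\\c&-a\end{pmatrix}$ with $a,b,c\in A$, viewed as a Lie algebra over $F$ under the commutator bracket. *)

theory Defs
  imports "HOL-Algebra.Module" "HOL-Algebra.QuotRing" "HOL-Algebra.Multiplicative_Group"
begin

text \<open>The additive order of \<open>\<one>\<close>; the value is \<open>0\<close> when that order is infinite.\<close>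

definition ring_characteristic :: "('a, 'm) ring_scheme \<Rightarrow> nat"
  where "ring_characteristic R = group.ord (add_monoid R) \<one>\<^bsub>R\<^esub>"

definition algebra_iso ::
  "('f, 'm) ring_scheme \<Rightarrow> ('f, 'a, 'k) module_scheme \<Rightarrow> ('f, 'b, 'l) module_scheme \<Rightarrow> ('a \<Rightarrow> 'b) set"
  where "algebra_iso F A B =
    {h \<in> ring_iso A B. \<forall>k \<in> carrier F. \<forall>x \<in> carrier A. h (k \<odot>\<^bsub>A\<^esub> x) = k \<odot>\<^bsub>B\<^esub> h x}"

definition is_algebra_iso ::
  "('f, 'm) ring_scheme \<Rightarrow> ('f, 'a, 'k) module_scheme \<Rightarrow> ('f, 'b, 'l) module_scheme \<Rightarrow> bool"
  where "is_algebra_iso F A B \<longleftrightarrow> algebra_iso F A B \<noteq> {}"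

text \<open>
  As for the library's modules, the fields \<open>mult\<close> and \<open>one\<close> that the record inherits
  carry no meaning for a Lie algebra.
\<close>

record ('a, 'b) lie_algebra = "('a, 'b) module" +
  bracket :: "'b \<Rightarrow> 'b \<Rightarrow> 'b"

locale lie_algebra = module F L
  for F (structure) and L :: "('a, 'b, 'c) lie_algebra_scheme" (structure) +
  assumes bracket_closed:
      "\<lbrakk>x \<in> carrier L; y \<in> carrier L\<rbrakk> \<Longrightarrow> bracket L x y \<in> carrier L"
    and bracket_add_left:
      "\<lbrakk>x \<in> carrier L; y \<in> carrier L; z \<in> carrier L\<rbrakk>
        \<Longrightarrow> bracket L (x \<oplus>\<^bsub>L\<^esub> y) z = bracket L x z \<oplus>\<^bsub>L\<^esub> bracket L y z"
    and bracket_add_right: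
      "\<lbrakk>x \<in> carrier L; y \<in> carrier L; z \<in> carrier L\<rbrakk>
        \<Longrightarrow> bracket L x (y \<oplus>\<^bsub>L\<^esub> z) = bracket L x y \<oplus>\<^bsub>L\<^esub> bracket L x z"
    and bracket_smult_left:
      "\<lbrakk>k \<in> carrier F; x \<in> carrier L; y \<in> carrier L\<rbrakk>
        \<Longrightarrow> bracket L (k \<odot>\<^bsub>L\<^esub> x) y = k \<odot>\<^bsub>L\<^esub> bracket L x y"
    and bracket_smult_right:
      "\<lbrakk>k \<in> carrier F; x \<in> carrier L; y \<in> carrier L\<rbrakk>
        \<Longrightarrow> bracket L x (k \<odot>\<^bsub>L\<^esub> y) = k \<odot>\<^bsub>L\<^esub> bracket L x y"
    and bracket_self:
      "x \<in> carrier L \<Longrightarrow> bracket L x x = \<zero>\<^bsub>L\<^esub>"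
    and jacobi:
      "\<lbrakk>x \<in> carrier L; y \<in> carrier L; z \<in> carrier L\<rbrakk>
        \<Longrightarrow> bracket L x (bracket L y z) \<oplus>\<^bsub>L\<^esub> bracket L y (bracket L z x)
            \<oplus>\<^bsub>L\<^esub> bracket L z (bracket L x y) = \<zero>\<^bsub>L\<^esub>"

definition lie_algebra_iso ::
  "('f, 'm) ring_scheme \<Rightarrow> ('f, 'a, 'k) lie_algebra_scheme \<Rightarrow> ('f, 'b, 'l) lie_algebra_scheme
    \<Rightarrow> ('a \<Rightarrow> 'b) set"
  where "lie_algebra_iso F L M =
    {h. bij_betw h (carrier L) (carrier M)
      \<and> (\<forall>x \<in> carrier L. \<forall>y \<in> carrier L. h (x \<oplus>\<^bsub>L\<^esub> y) = h x \<oplus>\<^bsub>M\<^esub> h y)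
      \<and> (\<forall>k \<in> carrier F. \<forall>x \<in> carrier L. h (k \<odot>\<^bsub>L\<^esub> x) = k \<odot>\<^bsub>M\<^esub> h x)
      \<and> (\<forall>x \<in> carrier L. \<forall>y \<in> carrier L. h (bracket L x y) = bracket M (h x) (h y))}"

definition is_lie_algebra_iso ::
  "('f, 'm) ring_scheme \<Rightarrow> ('f, 'a, 'k) lie_algebra_scheme \<Rightarrow> ('f, 'b, 'l) lie_algebra_scheme \<Rightarrow> bool"
  where "is_lie_algebra_iso F L M \<longleftrightarrow> lie_algebra_iso F L M \<noteq> {}"

text \<open>
  \<open>Mat2 a b c d\<close> has rows \<open>(a, b)\<close> and \<open>(c, d)\<close>. The entries come from a ring given by a
  carrier, so the library's matrices over type-class rings do not apply.
\<close>

datatype 'a mat2 = Mat2 'a 'a 'a 'a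

fun mat2_add :: "('a, 'm) ring_scheme \<Rightarrow> 'a mat2 \<Rightarrow> 'a mat2 \<Rightarrow> 'a mat2"
  where "mat2_add A (Mat2 a b c d) (Mat2 a' b' c' d') =
    Mat2 (a \<oplus>\<^bsub>A\<^esub> a') (b \<oplus>\<^bsub>A\<^esub> b') (c \<oplus>\<^bsub>A\<^esub> c') (d \<oplus>\<^bsub>A\<^esub> d')"

fun mat2_minus :: "('a, 'm) ring_scheme \<Rightarrow> 'a mat2 \<Rightarrow> 'a mat2 \<Rightarrow> 'a mat2"
  where "mat2_minus A (Mat2 a b c d) (Mat2 a' b' c' d') =
    Mat2 (a \<ominus>\<^bsub>A\<^esub> a') (b \<ominus>\<^bsub>A\<^esub> b') (c \<ominus>\<^bsub>A\<^esub> c') (d \<ominus>\<^bsub>A\<^esub> d')"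

fun mat2_mult :: "('a, 'm) ring_scheme \<Rightarrow> 'a mat2 \<Rightarrow> 'a mat2 \<Rightarrow> 'a mat2"
  where "mat2_mult A (Mat2 a b c d) (Mat2 a' b' c' d') =
    Mat2 (a \<otimes>\<^bsub>A\<^esub> a' \<oplus>\<^bsub>A\<^esub> b \<otimes>\<^bsub>A\<^esub> c') (a \<otimes>\<^bsub>A\<^esub> b' \<oplus>\<^bsub>A\<^esub> b \<otimes>\<^bsub>A\<^esub> d')
         (c \<otimes>\<^bsub>A\<^esub> a' \<oplus>\<^bsub>A\<^esub> d \<otimes>\<^bsub>A\<^esub> c') (c \<otimes>\<^bsub>A\<^esub> b' \<oplus>\<^bsub>A\<^esub> d \<otimes>\<^bsub>A\<^esub> d')"

fun mat2_smult :: "('f, 'a, 'm) module_scheme \<Rightarrow> 'f \<Rightarrow> 'a mat2 \<Rightarrow> 'a mat2"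
  where "mat2_smult A k (Mat2 a b c d) =
    Mat2 (k \<odot>\<^bsub>A\<^esub> a) (k \<odot>\<^bsub>A\<^esub> b) (k \<odot>\<^bsub>A\<^esub> c) (k \<odot>\<^bsub>A\<^esub> d)"

definition sl2 :: "('f, 'a, 'm) module_scheme \<Rightarrow> ('f, 'a mat2) lie_algebra"
  where "sl2 A =
    \<lparr>carrier = {Mat2 a b c (\<ominus>\<^bsub>A\<^esub> a) | a b c. a \<in> carrier A \<and> b \<in> carrier A \<and> c \<in> carrier A},
     mult = undefined, one = undefined,
     zero = Mat2 \<zero>\<^bsub>A\<^esub> \<zero>\<^bsub>A\<^esub> \<zero>\<^bsub>A\<^esub> \<zero>\<^bsub>A\<^esub>,
     add = mat2_add A,
     smult = mat2_smult A,
     bracket = (\<lambda>X Y. mat2_minus A (mat2_mult A X Y) (mat2_mult A Y X))\<rparr>"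

lemma ring_characteristic_eq_2_iff:
  assumes "domain R"
  shows "ring_characteristic R = 2 \<longleftrightarrow> \<one>\<^bsub>R\<^esub> \<oplus>\<^bsub>R\<^esub> \<one>\<^bsub>R\<^esub> = \<zero>\<^bsub>R\<^esub>"
proof -
  interpret domain R by fact
  let ?d = "group.ord (add_monoid R) \<one>\<^bsub>R\<^esub>"
  have *: "[n] \<cdot>\<^bsub>R\<^esub> \<one>\<^bsub>R\<^esub> = \<zero>\<^bsub>R\<^esub> \<longleftrightarrow> ?d dvd n" for n :: nat
    using group.pow_eq_id[OF a_group, of "\<one>\<^bsub>R\<^esub>" n] by (simp add: add_pow_def)
  have 1: "?d \<noteq> 1"
    using *[of 1] by auto
  have "\<one>\<^bsub>R\<^esub> \<oplus>\<^bsub>R\<^esub> \<one>\<^bsub>R\<^esub> = \<zero>\<^bsub>R\<^esub> \<longleftrightarrow> ?d dvd 2"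
    using *[of 2] by (simp add: numeral_2_eq_2)
  also have "\<dots> \<longleftrightarrow> ?d = 2"
  proof
    assume *: "?d dvd 2"
    then have "?d \<le> 2" "?d \<noteq> 0"
      by (auto simp: dvd_imp_le intro: gr0I)
    with 1 show "?d = 2"
      by linarith
  qed simp
  finally show ?thesis
    by (simp add: ring_characteristic_def)
qed

context cring
begin

lemma diff_add_diff:
  assumes "a \<in> carrier R" "b \<in> carrier R" "c \<in> carrier R" "d \<in> carrier R"
  shows "(a \<ominus> b) \<oplus> (c \<ominus> d) = (a \<oplus> c) \<ominus> (b \<oplus> d)"
  using assms by (simp add: minus_eq minus_add a_ac)

lemma diff_diff_diff:
  assumes "a \<in> carrier R" "b \<in> carrier R" "c \<in> carrier R" "d \<in> carrier R"
  shows "(a \<ominus> b) \<ominus> (c \<ominus> d) = (a \<oplus> d) \<ominus> (b \<oplus> c)"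
  using assms by (simp add: minus_eq minus_add a_ac)

lemma mult_diff:
  assumes "a \<in> carrier R" "b \<in> carrier R" "c \<in> carrier R"
  shows "a \<otimes> (b \<ominus> c) = a \<otimes> b \<ominus> a \<otimes> c"
  using assms by (simp add: minus_eq r_distr r_minus)

lemma diff_mult:
  assumes "a \<in> carrier R" "b \<in> carrier R" "c \<in> carrier R"
  shows "(b \<ominus> c) \<otimes> a = b \<otimes> a \<ominus> c \<otimes> a"
  using assms by (simp add: minus_eq l_distr l_minus)

lemma diff_eq_zero:
  assumes "a \<in> carrier R" "b \<in> carrier R"
  shows "a \<ominus> b = \<zero> \<longleftrightarrow> a = b"
  using assms by simp

lemma diff_eq_diff:
  assumes "a \<in> carrier R" "b \<in> carrier R" "c \<in> carrier R" "d \<in> carrier R"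
  shows "a \<ominus> b = c \<ominus> d \<longleftrightarrow> a \<oplus> d = c \<oplus> b"
proof -
  have "a \<ominus> b = c \<ominus> d \<longleftrightarrow> (a \<ominus> b) \<ominus> (c \<ominus> d) = \<zero>"
    using assms by simp
  then show ?thesis
    using assms by (simp add: diff_diff_diff a_comm)
qed

end

lemma sl2_lie_algebra:
  assumes "algebra F A"
  shows "lie_algebra F (sl2 A)"
proof -
  interpret A: cring A by (rule algebra.M_cring[OF assms])
  interpret FA: algebra F A by fact
  have ag: "abelian_group (sl2 A)"
  proof (rule abelian_groupI)
    fix x assume "x \<in> carrier (sl2 A)"
    then obtain a b c where x: "x = Mat2 a b c (\<ominus>\<^bsub>A\<^esub> a)"
      and abc: "a \<in> carrier A" "b \<in> carrier A" "c \<in> carrier A"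
      by (auto simp: sl2_def)
    show "\<exists>y\<in>carrier (sl2 A). y \<oplus>\<^bsub>sl2 A\<^esub> x = \<zero>\<^bsub>sl2 A\<^esub>"
      by (rule bexI[of _ "Mat2 (\<ominus>\<^bsub>A\<^esub> a) (\<ominus>\<^bsub>A\<^esub> b) (\<ominus>\<^bsub>A\<^esub> c) (\<ominus>\<^bsub>A\<^esub> (\<ominus>\<^bsub>A\<^esub> a))"])
        (use abc in \<open>auto simp: x sl2_def A.l_neg A.r_neg\<close>)
  qed (auto simp: sl2_def A.minus_add A.a_ac)
  have mod: "module F (sl2 A)"
    by (rule moduleI[OF FA.R_cring ag])
      (auto simp: sl2_def FA.smult_l_distr FA.smult_r_distr FA.smult_assoc1 FA.smult_r_minus A.minus_add)
  have smult_assoc2': "x \<otimes>\<^bsub>A\<^esub> (k \<odot>\<^bsub>A\<^esub> y) = k \<odot>\<^bsub>A\<^esub> (x \<otimes>\<^bsub>A\<^esub> y)"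
    if "k \<in> carrier F" "x \<in> carrier A" "y \<in> carrier A" for k x y
    using that by (metis A.m_comm FA.smult_assoc2 FA.smult_closed)
  note collect_minus = A.diff_add_diff A.diff_diff_diff A.mult_diff A.diff_mult A.diff_eq_diff A.diff_eq_zero
  note sl2 = sl2_def A.minus_closed
  show ?thesis
  proof (intro lie_algebra.intro lie_algebra_axioms.intro mod)
    fix x y assume "x \<in> carrier (sl2 A)" "y \<in> carrier (sl2 A)"
    then show "bracket (sl2 A) x y \<in> carrier (sl2 A)"
      by (auto simp: sl2 A.minus_eq A.minus_add A.l_minus A.r_minus A.a_ac A.m_ac)
  next
    fix x y z assume "x \<in> carrier (sl2 A)" "y \<in> carrier (sl2 A)" "z \<in> carrier (sl2 A)"
    then obtain a b c d a' b' c' d' a'' b'' c'' d''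
      where xyz: "x = Mat2 a b c d" "y = Mat2 a' b' c' d'" "z = Mat2 a'' b'' c'' d''"
        and [simp]: "a \<in> carrier A" "b \<in> carrier A" "c \<in> carrier A" "d \<in> carrier A"
          "a' \<in> carrier A" "b' \<in> carrier A" "c' \<in> carrier A" "d' \<in> carrier A"
          "a'' \<in> carrier A" "b'' \<in> carrier A" "c'' \<in> carrier A" "d'' \<in> carrier A"
      by (auto simp: sl2_def)
    show "bracket (sl2 A) (x \<oplus>\<^bsub>sl2 A\<^esub> y) z = bracket (sl2 A) x z \<oplus>\<^bsub>sl2 A\<^esub> bracket (sl2 A) y z"
      by (simp add: xyz sl2 collect_minus A.l_distr A.r_distr A.a_ac A.m_ac)
    show "bracket (sl2 A) x (y \<oplus>\<^bsub>sl2 A\<^esub> z) = bracket (sl2 A) x y \<oplus>\<^bsub>sl2 A\<^esub> bracket (sl2 A) x z"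
      by (simp add: xyz sl2 collect_minus A.l_distr A.r_distr A.a_ac A.m_ac)
    show "bracket (sl2 A) x (bracket (sl2 A) y z) \<oplus>\<^bsub>sl2 A\<^esub> bracket (sl2 A) y (bracket (sl2 A) z x)
        \<oplus>\<^bsub>sl2 A\<^esub> bracket (sl2 A) z (bracket (sl2 A) x y) = \<zero>\<^bsub>sl2 A\<^esub>"
      by (simp add: xyz sl2 collect_minus A.l_distr A.r_distr A.a_ac A.m_ac)
  next
    fix k x y assume "k \<in> carrier F" "x \<in> carrier (sl2 A)" "y \<in> carrier (sl2 A)"
    then show "bracket (sl2 A) (k \<odot>\<^bsub>sl2 A\<^esub> x) y = k \<odot>\<^bsub>sl2 A\<^esub> bracket (sl2 A) x y"
      and "bracket (sl2 A) x (k \<odot>\<^bsub>sl2 A\<^esub> y) = k \<odot>\<^bsub>sl2 A\<^esub> bracket (sl2 A) x y"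
      by (auto simp: sl2 A.minus_eq FA.smult_assoc2 smult_assoc2' FA.smult_r_distr FA.smult_r_minus A.l_minus A.r_minus)
  next
    fix x assume "x \<in> carrier (sl2 A)"
    then show "bracket (sl2 A) x x = \<zero>\<^bsub>sl2 A\<^esub>"
      by (auto simp: sl2 A.diff_eq_zero A.m_comm A.a_comm A.l_minus A.r_minus)
  qed
qed

end

theory Submission
  imports Defs
begin

text \<open>
  Why the theorem is true. An isomorphism \<open>R \<simeq> S\<close> acts entrywise on matrices, which gives one
  implication. For the other, the ring \<open>A\<close> is recovered from the Lie algebra \<open>sl\<^sub>2(A)\<close> as its
  centroid, that is, as the maps \<open>\<phi>\<close> with \<open>\<phi>[x, y] = [\<phi> x, y] = [x, \<phi> y]\<close>. Scaling by an
  element of \<open>A\<close> is such a map. Conversely, let \<open>u\<close> be half of the unit of \<open>A\<close>,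
  \<open>h = diag(u, -u)\<close>, and \<open>e\<close> the matrix unit above the diagonal. As \<open>h\<close> commutes with itself and
  2 is invertible, \<open>\<phi>\<close> maps \<open>h\<close> to a diagonal matrix, say \<open>\<alpha> h\<close>; then
  \<open>\<phi> e = \<phi>[h, e] = [\<alpha> h, e] = \<alpha> e\<close>. So \<open>\<phi> x\<close> and \<open>\<alpha> x\<close> have the same brackets with \<open>h\<close> and
  with \<open>e\<close>, and these two brackets determine an element of \<open>sl\<^sub>2(A)\<close>; hence \<open>\<phi>\<close> is scaling by
  \<open>\<alpha>\<close> (lemma \<open>bracket_commuting_sl2\<close>). A Lie isomorphism \<open>sl\<^sub>2(R) \<rightarrow> sl\<^sub>2(S)\<close> therefore conjugates
  scalings to scalings, and the induced correspondence between scalars is an isomorphism of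
  \<open>F\<close>-algebras.
\<close>

section \<open>Maps that commute with the bracket\<close>

text \<open>
  The centroid of a Lie algebra consists of the linear maps among these. For \<open>sl\<^sub>2\<close> over a ring
  in which 2 is invertible every such map is a scaling, hence linear.
\<close>

definition bracket_commuting :: "('f, 'a, 'k) lie_algebra_scheme \<Rightarrow> ('a \<Rightarrow> 'a) set"
  where "bracket_commuting L =
    {\<phi> \<in> carrier L \<rightarrow> carrier L. \<forall>x \<in> carrier L. \<forall>y \<in> carrier L.
      \<phi> (bracket L x y) = bracket L (\<phi> x) y \<and> \<phi> (bracket L x y) = bracket L x (\<phi> y)}"

lemma bracket_commutingD:
  assumes "\<phi> \<in> bracket_commuting L" "x \<in> carrier L" "y \<in> carrier L"
  shows "\<phi> (bracket L x y) = bracket L (\<phi> x) y" "\<phi> (bracket L x y) = bracket L x (\<phi> y)"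
  using assms unfolding bracket_commuting_def by blast+

lemma lie_algebra_isoD:
  assumes "h \<in> lie_algebra_iso F L M"
  shows "bij_betw h (carrier L) (carrier M)"
    and "\<And>x. x \<in> carrier L \<Longrightarrow> h x \<in> carrier M"
    and "\<And>x y. x \<in> carrier L \<Longrightarrow> y \<in> carrier L \<Longrightarrow> h (x \<oplus>\<^bsub>L\<^esub> y) = h x \<oplus>\<^bsub>M\<^esub> h y"
    and "\<And>k x. k \<in> carrier F \<Longrightarrow> x \<in> carrier L \<Longrightarrow> h (k \<odot>\<^bsub>L\<^esub> x) = k \<odot>\<^bsub>M\<^esub> h x"
    and "\<And>x y. x \<in> carrier L \<Longrightarrow> y \<in> carrier L \<Longrightarrow> h (bracket L x y) = bracket M (h x) (h y)"
  using assms by (auto simp: lie_algebra_iso_def dest: bij_betwE)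

lemma lie_algebra_iso_inv_into:
  assumes L: "lie_algebra F L" and h: "h \<in> lie_algebra_iso F L M"
  shows "inv_into (carrier L) h \<in> lie_algebra_iso F M L"
proof -
  interpret L: lie_algebra F L by fact
  note hD = lie_algebra_isoD[OF h]
  let ?g = "inv_into (carrier L) h"
  have g: "?g y \<in> carrier L" and hg: "h (?g y) = y" if "y \<in> carrier M" for y
    using hD(1) that by (auto simp: bij_betw_inv_into_right intro: bij_betw_apply[OF bij_betw_inv_into])
  have gI: "?g y = x" if "x \<in> carrier L" "h x = y" for x y
    using hD(1) that by (auto simp: bij_betw_inv_into_left)
  show ?thesis
    unfolding lie_algebra_iso_def
    by (auto intro!: gI simp: hD(3-5) g hg L.bracket_closed bij_betw_inv_into[OF hD(1)])
qed

lemma bracket_commuting_conj: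
  assumes L: "lie_algebra F L"
    and h: "h \<in> lie_algebra_iso F L M" and \<phi>: "\<phi> \<in> bracket_commuting L"
  shows "(\<lambda>y. h (\<phi> (inv_into (carrier L) h y))) \<in> bracket_commuting M"
proof -
  interpret L: lie_algebra F L by fact
  let ?g = "inv_into (carrier L) h"
  note hD = lie_algebra_isoD[OF h] and gD = lie_algebra_isoD[OF lie_algebra_iso_inv_into[OF L h]]
  have hg: "h (?g y) = y" if "y \<in> carrier M" for y
    using hD(1) that by (simp add: bij_betw_inv_into_right)
  have \<phi>c: "\<phi> x \<in> carrier L" if "x \<in> carrier L" for x
    using \<phi> that by (auto simp: bracket_commuting_def)
  have 1: "h (\<phi> (?g (bracket M x y))) = bracket M (h (\<phi> (?g x))) y"
    and 2: "h (\<phi> (?g (bracket M x y))) = bracket M x (h (\<phi> (?g y)))"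
    if xy: "x \<in> carrier M" "y \<in> carrier M" for x y
  proof -
    have "\<phi> (bracket L (?g x) (?g y)) = bracket L (\<phi> (?g x)) (?g y)"
      and "\<phi> (bracket L (?g x) (?g y)) = bracket L (?g x) (\<phi> (?g y))"
      using bracket_commutingD[OF \<phi> gD(2)[OF xy(1)] gD(2)[OF xy(2)]] .
    then show "h (\<phi> (?g (bracket M x y))) = bracket M (h (\<phi> (?g x))) y"
      and "h (\<phi> (?g (bracket M x y))) = bracket M x (h (\<phi> (?g y)))"
      using xy by (metis gD(2,5) hD(5) hg \<phi>c)+
  qed
  show ?thesis
    using 1 2 by (auto simp: bracket_commuting_def intro!: hD(2) \<phi>c gD(2))
qed


section \<open>Scalings of \<open>sl\<^sub>2(A)\<close>\<close>

abbreviation scale :: "('a, 'm) ring_scheme \<Rightarrow> 'a \<Rightarrow> 'a mat2 \<Rightarrow> 'a mat2"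
  where "scale A r \<equiv> map_mat2 (\<lambda>x. r \<otimes>\<^bsub>A\<^esub> x)"

abbreviation mat2_e :: "('a, 'm) ring_scheme \<Rightarrow> 'a mat2"
  where "mat2_e A \<equiv> Mat2 \<zero>\<^bsub>A\<^esub> \<one>\<^bsub>A\<^esub> \<zero>\<^bsub>A\<^esub> (\<ominus>\<^bsub>A\<^esub> \<zero>\<^bsub>A\<^esub>)"

lemma sl2_cases:
  assumes "X \<in> carrier (sl2 A)"
  obtains a b c where "X = Mat2 a b c (\<ominus>\<^bsub>A\<^esub> a)"
    "a \<in> carrier A" "b \<in> carrier A" "c \<in> carrier A"
  using assms by (auto simp: sl2_def)

lemma Mat2_in_sl2 [simp]:
  "Mat2 a b c d \<in> carrier (sl2 A) \<longleftrightarrow>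
    a \<in> carrier A \<and> b \<in> carrier A \<and> c \<in> carrier A \<and> d = \<ominus>\<^bsub>A\<^esub> a"
  by (auto simp: sl2_def)

lemma bracket_sl2:
  "bracket (sl2 A) X Y = mat2_minus A (mat2_mult A X Y) (mat2_mult A Y X)"
  by (simp add: sl2_def)

lemma add_sl2: "X \<oplus>\<^bsub>sl2 A\<^esub> Y = mat2_add A X Y"
  by (simp add: sl2_def)

lemma smult_sl2: "k \<odot>\<^bsub>sl2 A\<^esub> X = mat2_smult A k X"
  by (simp add: sl2_def)

text \<open>
  Facts about \<open>sl2 A\<close> that concern only the ring structure of \<open>A\<close>. The locale narrows the
  record type of \<^locale>\<open>cring\<close> to the algebra records on which \<^const>\<open>sl2\<close> is defined.
\<close>

locale sl2_coefficients = cring A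
  for A :: "('f, 'a, 'm) module_scheme" (structure)
begin

lemma scale_closed:
  assumes "r \<in> carrier A" "X \<in> carrier (sl2 A)"
  shows "scale A r X \<in> carrier (sl2 A)"
  using assms by (auto elim!: sl2_cases simp: r_minus)

lemma scale_bracket:
  assumes "r \<in> carrier A" "X \<in> carrier (sl2 A)" "Y \<in> carrier (sl2 A)"
  shows scale_bracket_left: "bracket (sl2 A) (scale A r X) Y = scale A r (bracket (sl2 A) X Y)"
    and scale_bracket_right: "bracket (sl2 A) X (scale A r Y) = scale A r (bracket (sl2 A) X Y)"
  using assms
  by (auto elim!: sl2_cases simp: bracket_sl2 minus_eq r_distr l_distr r_minus l_minus m_ac)

lemma scale_bracket_commuting:
  assumes "r \<in> carrier A"
  shows "scale A r \<in> bracket_commuting (sl2 A)"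
  using assms by (auto simp: bracket_commuting_def scale_bracket scale_closed)

lemma scale_e_inject:
  assumes "r \<in> carrier A" "s \<in> carrier A" "scale A r (mat2_e A) = scale A s (mat2_e A)"
  shows "r = s"
  using assms by simp

lemma scale_ops:
  assumes "r \<in> carrier A" "s \<in> carrier A" "X \<in> carrier (sl2 A)"
  shows scale_add: "scale A (r \<oplus> s) X = scale A r X \<oplus>\<^bsub>sl2 A\<^esub> scale A s X"
    and scale_mult: "scale A (r \<otimes> s) X = scale A r (scale A s X)"
  using assms by (auto elim!: sl2_cases simp: add_sl2 l_distr m_assoc)

lemma scale_one: "X \<in> carrier (sl2 A) \<Longrightarrow> scale A \<one> X = X"
  by (auto elim!: sl2_cases)

lemma bracket_h:
  assumes "u \<in> carrier A" "u \<oplus> u = \<one>" "a \<in> carrier A" "b \<in> carrier A" "c \<in> carrier A"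
  shows "bracket (sl2 A) (Mat2 a b c (\<ominus> a)) (Mat2 u \<zero> \<zero> (\<ominus> u)) = Mat2 \<zero> (\<ominus> b) c \<zero>"
    and "bracket (sl2 A) (Mat2 u \<zero> \<zero> (\<ominus> u)) (Mat2 a b c (\<ominus> a)) = Mat2 \<zero> b (\<ominus> c) \<zero>"
proof -
  have ux: "u \<otimes> x \<oplus> u \<otimes> x = x" if "x \<in> carrier A" for x
    using assms that by (metis l_distr l_one)
  have nux: "\<ominus> (u \<otimes> x) \<oplus> \<ominus> (u \<otimes> x) = \<ominus> x" if "x \<in> carrier A" for x
    using assms(1) that ux[OF that] by (metis minus_add m_closed)
  show "bracket (sl2 A) (Mat2 a b c (\<ominus> a)) (Mat2 u \<zero> \<zero> (\<ominus> u)) = Mat2 \<zero> (\<ominus> b) c \<zero>"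
    and "bracket (sl2 A) (Mat2 u \<zero> \<zero> (\<ominus> u)) (Mat2 a b c (\<ominus> a)) = Mat2 \<zero> b (\<ominus> c) \<zero>"
    using assms(1,3-) by (simp_all add: bracket_sl2 minus_eq r_minus l_minus m_comm[of _ u] ux nux r_neg l_neg)
qed

lemma bracket_e:
  assumes "a \<in> carrier A" "b \<in> carrier A" "c \<in> carrier A"
  shows "bracket (sl2 A) (Mat2 a b c (\<ominus> a)) (mat2_e A) = Mat2 (\<ominus> c) (a \<oplus> a) \<zero> c"
  using assms by (simp add: bracket_sl2 minus_eq r_minus l_minus)

lemma double_cancel:
  assumes "u \<in> carrier A" "u \<oplus> u = \<one>" "a \<in> carrier A" "b \<in> carrier A" "a \<oplus> a = b \<oplus> b"
  shows "a = b"
proof -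
  have "u \<otimes> (x \<oplus> x) = x" if "x \<in> carrier A" for x
    using assms that by (metis r_distr l_distr l_one)
  then show ?thesis
    using assms(3-5) by metis
qed

text \<open>
  The bracket with \<open>h\<close> shows the off-diagonal entries and the bracket with \<open>e\<close> shows twice the
  diagonal one, so an element is determined by both.
\<close>

lemma sl2_eqI:
  assumes "u \<in> carrier A" "u \<oplus> u = \<one>" "X \<in> carrier (sl2 A)" "Y \<in> carrier (sl2 A)"
    and "bracket (sl2 A) X (Mat2 u \<zero> \<zero> (\<ominus> u)) = bracket (sl2 A) Y (Mat2 u \<zero> \<zero> (\<ominus> u))"
    and "bracket (sl2 A) X (mat2_e A) = bracket (sl2 A) Y (mat2_e A)"
  shows "X = Y"
proof -
  obtain a b c where X: "X = Mat2 a b c (\<ominus> a)" "a \<in> carrier A" "b \<in> carrier A" "c \<in> carrier A"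
    using assms(3) by (rule sl2_cases)
  obtain a' b' c' where Y: "Y = Mat2 a' b' c' (\<ominus> a')" "a' \<in> carrier A" "b' \<in> carrier A" "c' \<in> carrier A"
    using assms(4) by (rule sl2_cases)
  have "\<ominus> b = \<ominus> b'" "c = c'"
    using assms(5) by (simp_all only: X Y bracket_h[OF assms(1,2)] mat2.inject)
  moreover have "a \<oplus> a = a' \<oplus> a'"
    using assms(6) by (simp only: X Y bracket_e mat2.inject)
  ultimately show ?thesis
    using X Y double_cancel[OF assms(1,2)] by (metis minus_minus)
qed

text \<open>
  The two test elements suffice because \<open>\<phi>\<close> can be moved between the arguments of a bracket:
  knowing \<open>\<phi>\<close> on \<open>h\<close> and \<open>e\<close> means knowing the brackets of every \<open>\<phi> X\<close> with them. The
  argument never decomposes \<open>X\<close> as a sum, so linearity of \<open>\<phi>\<close> comes out as a consequence.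
\<close>

lemma bracket_commuting_sl2:
  assumes u: "u \<in> carrier A" "u \<oplus> u = \<one>" and \<phi>: "\<phi> \<in> bracket_commuting (sl2 A)"
  obtains \<alpha> where "\<alpha> \<in> carrier A" "\<And>X. X \<in> carrier (sl2 A) \<Longrightarrow> \<phi> X = scale A \<alpha> X"
proof -
  let ?h = "Mat2 u \<zero> \<zero> (\<ominus> u)" and ?B = "bracket (sl2 A)"
  have h: "?h \<in> carrier (sl2 A)" and e: "mat2_e A \<in> carrier (sl2 A)"
    using u by auto
  have \<phi>c: "\<phi> X \<in> carrier (sl2 A)" if "X \<in> carrier (sl2 A)" for X
    using \<phi> that by (auto simp: bracket_commuting_def)
  note \<phi>B = bracket_commutingD[OF \<phi>]
  obtain p q s where ph: "\<phi> ?h = Mat2 p q s (\<ominus> p)" "p \<in> carrier A" "q \<in> carrier A" "s \<in> carrier A"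
    using \<phi>c[OF h] by (rule sl2_cases)
  have "?B (Mat2 p q s (\<ominus> p)) ?h = ?B ?h (Mat2 p q s (\<ominus> p))"
    using \<phi>B[OF h h] ph(1) by simp
  then have "\<ominus> q = q" "s = \<ominus> s"
    by (simp_all only: ph bracket_h[OF u] mat2.inject)
  then have "q \<oplus> q = \<zero> \<oplus> \<zero>" "s \<oplus> s = \<zero> \<oplus> \<zero>"
    using ph r_neg[of q] r_neg[of s] by auto
  then have qs: "q = \<zero>" "s = \<zero>"
    using double_cancel[OF u] ph by blast+
  \<comment> \<open>\<open>\<phi> h = diag(p, -p)\<close> and \<open>h = diag(1/2, -1/2)\<close>, so the scalar is twice \<open>p\<close>.\<close>
  define \<alpha> where "\<alpha> = p \<oplus> p"
  have \<alpha>: "\<alpha> \<in> carrier A"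
    using ph by (simp add: \<alpha>_def)
  have "\<alpha> \<otimes> u = p"
    using ph u by (metis \<alpha>_def l_distr r_distr r_one)
  then have \<phi>h: "\<phi> ?h = scale A \<alpha> ?h"
    using \<alpha> u by (simp add: ph(1) qs r_minus)
  \<comment> \<open>The factor \<open>u = 1/2\<close> in \<open>h\<close> makes \<open>e\<close> an eigenvector of eigenvalue 1.\<close>
  have he: "?B ?h (mat2_e A) = mat2_e A"
    using u by (subst bracket_e) simp_all
  have \<phi>e: "\<phi> (mat2_e A) = scale A \<alpha> (mat2_e A)"
    using \<phi>B(1)[OF h e] scale_bracket_left[OF \<alpha> h e] by (simp only: he \<phi>h)
  have "\<phi> X = scale A \<alpha> X" if X: "X \<in> carrier (sl2 A)" for X
  proof (rule sl2_eqI[OF u \<phi>c[OF X] scale_closed[OF \<alpha> X]])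
    show "?B (\<phi> X) ?h = ?B (scale A \<alpha> X) ?h"
      using \<phi>B[OF X h] by (simp only: \<phi>h scale_bracket[OF \<alpha> X h])
    show "?B (\<phi> X) (mat2_e A) = ?B (scale A \<alpha> X) (mat2_e A)"
      using \<phi>B[OF X e] by (simp only: \<phi>e scale_bracket[OF \<alpha> X e])
  qed
  with \<alpha> show thesis
    by (rule that)
qed

end

lemma scale_smult:
  assumes "algebra F A" "k \<in> carrier F" "r \<in> carrier A" "X \<in> carrier (sl2 A)"
  shows "scale A (k \<odot>\<^bsub>A\<^esub> r) X = k \<odot>\<^bsub>sl2 A\<^esub> scale A r X"
proof -
  interpret A: sl2_coefficients A
    by (rule sl2_coefficients.intro[OF algebra.M_cring[OF assms(1)]])
  interpret algebra F A by fact
  show ?thesis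
    using assms(2-) by (auto elim!: sl2_cases simp: smult_sl2 smult_assoc2)
qed


section \<open>Lie isomorphisms induce algebra isomorphisms\<close>

text \<open>
  Conjugation by \<open>h\<close> preserves the property of commuting with the bracket, which on the side of
  \<open>S\<close> characterises scalings.
\<close>

lemma lie_iso_conj_scale:
  assumes R: "algebra F R" and S: "algebra F S"
    and u: "u \<in> carrier S" "u \<oplus>\<^bsub>S\<^esub> u = \<one>\<^bsub>S\<^esub>"
    and h: "h \<in> lie_algebra_iso F (sl2 R) (sl2 S)" and r: "r \<in> carrier R"
  shows "\<exists>s \<in> carrier S. \<forall>X \<in> carrier (sl2 R). h (scale R r X) = scale S s (h X)"
proof -
  interpret R: sl2_coefficients R
    by (rule sl2_coefficients.intro[OF algebra.M_cring[OF R]])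
  interpret S: sl2_coefficients S
    by (rule sl2_coefficients.intro[OF algebra.M_cring[OF S]])
  note hD = lie_algebra_isoD[OF h]
  let ?\<psi> = "\<lambda>Y. h (scale R r (inv_into (carrier (sl2 R)) h Y))"
  have "?\<psi> \<in> bracket_commuting (sl2 S)"
    by (intro bracket_commuting_conj[OF _ h] sl2_lie_algebra R R.scale_bracket_commuting r)
  then obtain s where s: "s \<in> carrier S" "\<And>Y. Y \<in> carrier (sl2 S) \<Longrightarrow> ?\<psi> Y = scale S s Y"
    using S.bracket_commuting_sl2[OF u] by blast
  have "h (scale R r X) = scale S s (h X)" if "X \<in> carrier (sl2 R)" for X
    using s(2)[OF hD(2)[OF that]] bij_betw_inv_into_left[OF hD(1) that] by simp
  with s(1) show ?thesis
    by blast
qed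

text \<open>
  The scalar \<open>\<sigma> r\<close> is determined by its action on \<open>sl\<^sub>2(S)\<close>, and composition, sum and \<open>F\<close>-multiples
  of scalings are the scalings by the product, sum and \<open>F\<close>-multiples of their scalars; this makes
  \<open>\<sigma>\<close> a homomorphism of algebras. Surjectivity is the same fact for the inverse of \<open>h\<close>.
\<close>

lemma algebra_iso_of_lie_iso:
  assumes R: "algebra F R" and S: "algebra F S"
    and u: "u \<in> carrier R" "u \<oplus>\<^bsub>R\<^esub> u = \<one>\<^bsub>R\<^esub>" and v: "v \<in> carrier S" "v \<oplus>\<^bsub>S\<^esub> v = \<one>\<^bsub>S\<^esub>"
    and h: "h \<in> lie_algebra_iso F (sl2 R) (sl2 S)"
  shows "is_algebra_iso F R S"
proof -
  interpret R: sl2_coefficients R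
    by (rule sl2_coefficients.intro[OF algebra.M_cring[OF R]])
  interpret S: sl2_coefficients S
    by (rule sl2_coefficients.intro[OF algebra.M_cring[OF S]])
  interpret FR: algebra F R by fact
  interpret FS: algebra F S by fact
  note hD = lie_algebra_isoD[OF h]
  let ?g = "inv_into (carrier (sl2 R)) h"
  have g: "?g \<in> lie_algebra_iso F (sl2 S) (sl2 R)"
    by (rule lie_algebra_iso_inv_into[OF sl2_lie_algebra[OF R] h])
  note gD = lie_algebra_isoD[OF g]
  have gh: "?g (h X) = X" if "X \<in> carrier (sl2 R)" for X
    using hD(1) that by (simp add: bij_betw_inv_into_left)
  have hg: "h (?g Y) = Y" if "Y \<in> carrier (sl2 S)" for Y
    using hD(1) that by (simp add: bij_betw_inv_into_right)
  \<comment> \<open>\<open>T r s\<close>: conjugation by \<open>h\<close> turns scaling by \<open>r\<close> into scaling by \<open>s\<close>. It is the graph of the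
    isomorphism.\<close>
  define T where "T r s \<longleftrightarrow> s \<in> carrier S \<and> (\<forall>X \<in> carrier (sl2 R). h (scale R r X) = scale S s (h X))"
    for r s
  have T_unique: "s = s'" if "T r s" "T r s'" for r s s'
  proof -
    have e: "mat2_e S \<in> carrier (sl2 S)"
      by simp
    have "scale S s (mat2_e S) = scale S s' (mat2_e S)"
      using that gD(2)[OF e] hg[OF e] unfolding T_def by metis
    then show ?thesis
      using that S.scale_e_inject by (simp only: T_def)
  qed
  have "\<exists>s. T r s" if "r \<in> carrier R" for r
    using lie_iso_conj_scale[OF R S v h that] by (auto simp: T_def)
  then obtain \<sigma> where \<sigma>: "\<And>r. r \<in> carrier R \<Longrightarrow> T r (\<sigma> r)"
    by metis
  have \<sigma>c: "\<sigma> r \<in> carrier S" if "r \<in> carrier R" for r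
    using \<sigma>[OF that] by (simp add: T_def)
  have \<sigma>_eq: "h (scale R r X) = scale S (\<sigma> r) (h X)" if "r \<in> carrier R" "X \<in> carrier (sl2 R)" for r X
    using \<sigma> that by (simp add: T_def)
  have \<sigma>I: "\<sigma> r = s" if "r \<in> carrier R" "s \<in> carrier S"
    "\<And>X. X \<in> carrier (sl2 R) \<Longrightarrow> h (scale R r X) = scale S s (h X)" for r s
    using T_unique[OF \<sigma>[OF that(1)]] that(2,3) by (simp add: T_def)
  have hom: "\<sigma> \<in> ring_hom R S"
  proof (rule ring_hom_memI)
    fix r r' assume r: "r \<in> carrier R" "r' \<in> carrier R"
    show "\<sigma> (r \<otimes>\<^bsub>R\<^esub> r') = \<sigma> r \<otimes>\<^bsub>S\<^esub> \<sigma> r'"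
      using r by (intro \<sigma>I) (simp_all only: R.m_closed S.m_closed \<sigma>c R.scale_mult S.scale_mult \<sigma>_eq R.scale_closed hD(2))
    show "\<sigma> (r \<oplus>\<^bsub>R\<^esub> r') = \<sigma> r \<oplus>\<^bsub>S\<^esub> \<sigma> r'"
      using r by (intro \<sigma>I) (simp_all only: R.add.m_closed S.add.m_closed \<sigma>c R.scale_add S.scale_add \<sigma>_eq R.scale_closed hD(2,3))
  next
    show "\<sigma> \<one>\<^bsub>R\<^esub> = \<one>\<^bsub>S\<^esub>"
      by (intro \<sigma>I)
        (simp_all only: R.one_closed S.one_closed R.scale_one S.scale_one hD(2))
  qed (rule \<sigma>c)
  have smult: "\<sigma> (k \<odot>\<^bsub>R\<^esub> r) = k \<odot>\<^bsub>S\<^esub> \<sigma> r" if "k \<in> carrier F" "r \<in> carrier R" for k r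
    using that
    by (intro \<sigma>I) (simp_all only: FR.smult_closed FS.smult_closed \<sigma>c scale_smult[OF R] scale_smult[OF S]
        \<sigma>_eq R.scale_closed hD(2,4))
  have inj: "inj_on \<sigma> (carrier R)"
  proof (rule inj_onI)
    fix r r' assume r: "r \<in> carrier R" "r' \<in> carrier R" and eq: "\<sigma> r = \<sigma> r'"
    have e: "mat2_e R \<in> carrier (sl2 R)"
      by simp
    have "h (scale R r (mat2_e R)) = h (scale R r' (mat2_e R))"
      using \<sigma>_eq[OF r(1) e] \<sigma>_eq[OF r(2) e] eq by simp
    then have "scale R r (mat2_e R) = scale R r' (mat2_e R)"
      using gh R.scale_closed[OF r(1) e] R.scale_closed[OF r(2) e] by metis
    then show "r = r'"
      using r R.scale_e_inject by blast
  qed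
  have surj: "\<exists>r \<in> carrier R. \<sigma> r = s" if s: "s \<in> carrier S" for s
  proof -
    obtain r where r: "r \<in> carrier R"
      and *: "\<And>Y. Y \<in> carrier (sl2 S) \<Longrightarrow> ?g (scale S s Y) = scale R r (?g Y)"
      using lie_iso_conj_scale[OF S R u g s] by blast
    have "h (scale R r X) = scale S s (h X)" if X: "X \<in> carrier (sl2 R)" for X
      using *[OF hD(2)[OF X]] hg[OF S.scale_closed[OF s hD(2)[OF X]]] by (simp only: gh[OF X])
    with r s \<sigma>I show ?thesis
      by blast
  qed
  have "bij_betw \<sigma> (carrier R) (carrier S)"
    using inj surj \<sigma>c by (auto simp: bij_betw_def)
  with hom smult have "\<sigma> \<in> algebra_iso F R S"
    by (simp add: algebra_iso_def ring_iso_def)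
  then show ?thesis
    by (auto simp: is_algebra_iso_def)
qed


section \<open>Algebra isomorphisms induce Lie isomorphisms\<close>

lemma lie_iso_of_algebra_iso:
  assumes R: "algebra F R" and S: "algebra F S" and f: "f \<in> algebra_iso F R S"
  shows "map_mat2 f \<in> lie_algebra_iso F (sl2 R) (sl2 S)"
proof -
  interpret R: sl2_coefficients R
    by (rule sl2_coefficients.intro[OF algebra.M_cring[OF R]])
  interpret S: sl2_coefficients S
    by (rule sl2_coefficients.intro[OF algebra.M_cring[OF S]])
  have hom: "f \<in> ring_hom R S" and bij: "bij_betw f (carrier R) (carrier S)"
    and smult: "\<And>k x. k \<in> carrier F \<Longrightarrow> x \<in> carrier R \<Longrightarrow> f (k \<odot>\<^bsub>R\<^esub> x) = k \<odot>\<^bsub>S\<^esub> f x"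
    using f by (auto simp: algebra_iso_def ring_iso_def)
  interpret f: ring_hom_cring R S f
    by unfold_locales (rule hom)
  have f_minus: "f (a \<ominus>\<^bsub>R\<^esub> b) = f a \<ominus>\<^bsub>S\<^esub> f b" if "a \<in> carrier R" "b \<in> carrier R" for a b
    using that by (simp add: R.minus_eq S.minus_eq)
  have inj: "inj_on (map_mat2 f) (carrier (sl2 R))"
    using bij by (auto intro!: inj_onI elim!: sl2_cases simp: bij_betw_def inj_on_def)
  have "Y \<in> map_mat2 f ` carrier (sl2 R)" if Y_in: "Y \<in> carrier (sl2 S)" for Y
  proof -
    obtain a' b' c' where Y: "Y = Mat2 a' b' c' (\<ominus>\<^bsub>S\<^esub> a')"
      and c: "a' \<in> carrier S" "b' \<in> carrier S" "c' \<in> carrier S"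
      using Y_in by (rule sl2_cases)
    have *: "\<exists>x \<in> carrier R. f x = y" if "y \<in> carrier S" for y
      using bij_betw_imp_surj_on[OF bij] that by (metis imageE)
    obtain a b c where "a \<in> carrier R" "b \<in> carrier R" "c \<in> carrier R" "f a = a'" "f b = b'" "f c = c'"
      using *[OF c(1)] *[OF c(2)] *[OF c(3)] by blast
    then show ?thesis
      by (intro image_eqI[of _ _ "Mat2 a b c (\<ominus>\<^bsub>R\<^esub> a)"]) (auto simp: Y)
  qed
  moreover have "map_mat2 f X \<in> carrier (sl2 S)" if "X \<in> carrier (sl2 R)" for X
    using that by (auto elim!: sl2_cases)
  ultimately have "bij_betw (map_mat2 f) (carrier (sl2 R)) (carrier (sl2 S))"
    using inj by (auto simp: bij_betw_def)
  then show ?thesis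
    by (auto simp: lie_algebra_iso_def add_sl2 smult_sl2 bracket_sl2 f_minus smult
        elim!: sl2_cases)
qed

lemma algebra_half:
  assumes "field F" and "ring_characteristic F \<noteq> 2" and "algebra F A"
  obtains u where "u \<in> carrier A" "u \<oplus>\<^bsub>A\<^esub> u = \<one>\<^bsub>A\<^esub>"
proof -
  interpret F: field F by fact
  interpret A: sl2_coefficients A
    by (rule sl2_coefficients.intro[OF algebra.M_cring[OF assms(3)]])
  interpret algebra F A by fact
  let ?two = "\<one>\<^bsub>F\<^esub> \<oplus>\<^bsub>F\<^esub> \<one>\<^bsub>F\<^esub>" and ?half = "inv\<^bsub>F\<^esub> (\<one>\<^bsub>F\<^esub> \<oplus>\<^bsub>F\<^esub> \<one>\<^bsub>F\<^esub>)"
  have "?two \<noteq> \<zero>\<^bsub>F\<^esub>"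
    using assms(2) ring_characteristic_eq_2_iff[OF F.domain_axioms] by simp
  then have two: "?two \<in> Units F"
    by (simp add: F.field_Units)
  have half: "?half \<in> carrier F"
    using two by simp
  have "?half \<oplus>\<^bsub>F\<^esub> ?half = ?half \<otimes>\<^bsub>F\<^esub> ?two"
    using half by (simp add: F.r_distr)
  also have "\<dots> = \<one>\<^bsub>F\<^esub>"
    using two by simp
  finally have "?half \<odot>\<^bsub>A\<^esub> \<one>\<^bsub>A\<^esub> \<oplus>\<^bsub>A\<^esub> ?half \<odot>\<^bsub>A\<^esub> \<one>\<^bsub>A\<^esub> = \<one>\<^bsub>A\<^esub>"
    using half by (simp flip: smult_l_distr)
  with half show thesis
    by (intro that[of "?half \<odot>\<^bsub>A\<^esub> \<one>\<^bsub>A\<^esub>"]) simp_all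
qed

theorem proposition10:
  fixes F :: "('f, 'm) ring_scheme"
    and R :: "('f, 'r, 'k) module_scheme"
    and S :: "('f, 's, 'l) module_scheme"
  assumes "field F" and "ring_characteristic F \<noteq> 2"
    and "algebra F R" and "domain R"
    and "algebra F S"
  shows "is_lie_algebra_iso F (sl2 R) (sl2 S) \<longleftrightarrow> is_algebra_iso F R S"
proof
  assume "is_lie_algebra_iso F (sl2 R) (sl2 S)"
  then obtain h where "h \<in> lie_algebra_iso F (sl2 R) (sl2 S)"
    by (auto simp: is_lie_algebra_iso_def)
  moreover obtain u where "u \<in> carrier R" "u \<oplus>\<^bsub>R\<^esub> u = \<one>\<^bsub>R\<^esub>"
    using algebra_half[OF assms(1-3)] .
  moreover obtain v where "v \<in> carrier S" "v \<oplus>\<^bsub>S\<^esub> v = \<one>\<^bsub>S\<^esub>"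
    using algebra_half[OF assms(1,2,5)] .
  ultimately show "is_algebra_iso F R S"
    using algebra_iso_of_lie_iso[OF assms(3,5)] by blast
next
  assume "is_algebra_iso F R S"
  then show "is_lie_algebra_iso F (sl2 R) (sl2 S)"
    using lie_iso_of_algebra_iso[OF assms(3,5)]
    by (auto simp: is_algebra_iso_def is_lie_algebra_iso_def)
qed

end
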